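(* Let $X$ be a non-empty set, $Y$ a real Hausdorff locally convex topological vector space and $f,g:X\to Y$ two functions. Let $\varphi\in Y^*\setminus\{0\}$ and $r\in\mathbb{R}$ be such that the set $$K:=\{x\in X : \varphi(f(x))\leq r\}$$ is non-empty. Assume also that the set $\{(f(x),g(x)) : x\in K\}$ is compact in $Y\times Y$ and that $g(K)\cap\varphi^{-1}(0)=\emptyset$. Then there exist a compact interval $[a^*,b^*]\subseteq\mathbb{R}$ and a point $x^*\in K$ satisfying $$\varphi(f(x^* )+\lambda g(x^* ))>r\quad\text{for all }\lambda\in (a^*,b^* ),$$ such that, if we put $$V=\bigcup_{\lambda\in (a^*,b^* )}\{x\in X : \varphi(f(x)+\lambda g(x))>r\},$$ at least one of the following assertions holds: $(q_1)$ $\varphi(f(x^* )+a^*g(x^* ))=r$ and $(f+a^*g)(V)\cap \varphi^{-1}((-\infty,r])\subseteq\partial\big((f+a^*g)(V)\big)\cap \varphi^{-1}(r)$; $(q_2)$ $\varphi(f(x^* )+b^*g(x^* ))=r$ and $(f+b^*g)(V)\cap \varphi^{-1}((-\infty,r])\subseteq\partial\big((f+b^*g)(V)\big)\cap \varphi^{-1}(r)$.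
   Context: "Interval" means a non-empty connected subset of $\mathbb{R}$ with more than one point (so $a^*<b^*$). $Y^*$ is the topological dual of $Y$ (continuous linear functionals $Y\to\mathbb{R}$). $\partial$ denotes the topological boundary in $Y$. $(a^*,b^* )$ denotes the open interval. *)

theory Defs
  imports "HOL-Analysis.Analysis"
begin

(* Joint continuity of addition comes from topological_ab_group_add; joint continuity of scalar
   multiplication is stated in the same filter style, with nhds a \<times>\<^sub>F nhds b the
   neighbourhood filter of (a, b). No separation axiom is built in. *)
class topological_real_vector = real_vector + topological_ab_group_add +
  assumes tendsto_scaleR_Pair:
    "LIM p (nhds (a::real) \<times>\<^sub>F nhds x). fst p *\<^sub>R snd p :> nhds (a *\<^sub>R x)"

(* The library constant convex cannot occur in a class specification (its sort constraint
   real_vector is rejected there), so its definition is written out;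
   see convex_nhds_base below. *)
class locally_convex_space = topological_real_vector +
  assumes convex_nhds_base_raw:
    "open U \<Longrightarrow> 0 \<in> U \<Longrightarrow> \<exists>C. open C \<and> 0 \<in> C \<and> C \<subseteq> U \<and>
      (\<forall>x\<in>C. \<forall>y\<in>C. \<forall>u\<ge>0. \<forall>v\<ge>0. u + v = 1 \<longrightarrow> u *\<^sub>R x + v *\<^sub>R y \<in> C)"

lemma convex_nhds_base:
  fixes U :: "'a::locally_convex_space set"
  assumes "open U" "0 \<in> U"
  shows "\<exists>C. open C \<and> 0 \<in> C \<and> C \<subseteq> U \<and> convex C"
  using convex_nhds_base_raw[OF assms] unfolding convex_def .

lemma continuous_on_scaleR_pair:
  "continuous_on UNIV (\<lambda>p :: real \<times> 'a::topological_real_vector. fst p *\<^sub>R snd p)"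
  unfolding continuous_on_def
proof
  fix p :: "real \<times> 'a"
  show "((\<lambda>p. fst p *\<^sub>R snd p) \<longlongrightarrow> fst p *\<^sub>R snd p) (at p)"
    using tendsto_mono[OF at_within_le_nhds[of p UNIV]] tendsto_scaleR_Pair[of "fst p" "snd p"]
    by (simp add: nhds_prod[symmetric])
qed

instance real_normed_vector \<subseteq> locally_convex_space
proof
  fix a :: real and x :: 'a
  show "LIM p (nhds a \<times>\<^sub>F nhds x). fst p *\<^sub>R snd p :> nhds (a *\<^sub>R x)"
    unfolding nhds_prod[symmetric]
    using tendsto_scaleR[OF tendsto_fst[OF filterlim_ident, of "(a, x)"]
        tendsto_snd[OF filterlim_ident, of "(a, x)"]] by simp
next
  fix U :: "'a set"
  assume "open U" "0 \<in> U"
  then obtain e where "e > 0" "ball 0 e \<subseteq> U"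
    by (meson open_contains_ball)
  then show "\<exists>C. open C \<and> 0 \<in> C \<and> C \<subseteq> U \<and>
      (\<forall>x\<in>C. \<forall>y\<in>C. \<forall>u\<ge>0. \<forall>v\<ge>0. u + v = 1 \<longrightarrow> u *\<^sub>R x + v *\<^sub>R y \<in> C)"
    unfolding convex_def[symmetric] by (intro exI[of _ "ball 0 e"]) auto
qed

end

theory Submission
  imports Defs
begin

text \<open>Composing with \<open>\<phi>\<close> turns every \<open>x\<close> into the affine function
  \<open>l \<mapsto> \<phi> (f x) + l * \<phi> (g x)\<close>. If some \<open>x \<in> K\<close> gives an increasing one, let
  \<open>a\<close> be the largest, over all such \<open>x\<close>, of the points at which it takes the value \<open>r\<close>;
  compactness provides a maximiser \<open>x0\<close>, and \<open>a \<ge> 0\<close>. To the right of \<open>a\<close>, no function that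
  is below \<open>r\<close> at \<open>a\<close> ever exceeds \<open>r\<close>: so \<open>f + a g\<close> maps \<open>V\<close> into the half-space
  \<open>\<phi> \<ge> r\<close>, whose bounding hyperplane contains no interior point of the image.
  If no \<open>x \<in> K\<close> gives an increasing function, replace \<open>g\<close> by \<open>- g\<close>.\<close>

text \<open>A nonzero linear functional strictly decreases along some line through \<open>y\<close>;
  were \<open>y\<close> interior, a short move along that line would stay in \<open>W\<close> and
  undercut the minimum.\<close>

lemma supporting_hyperplane_point_in_frontier:
  fixes \<phi> :: "'y::topological_real_vector \<Rightarrow> real"
  assumes lin: "linear \<phi>" and "\<phi> \<noteq> (\<lambda>y. 0)" and "y \<in> W"
    and min: "\<And>w. w \<in> W \<Longrightarrow> \<phi> y \<le> \<phi> w"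
  shows "y \<in> frontier W"
proof -
  have "y \<notin> interior W"
  proof
    assume int: "y \<in> interior W"
    obtain w where w: "\<phi> w \<noteq> 0"
      using \<open>\<phi> \<noteq> (\<lambda>y. 0)\<close> by auto
    \<comment> \<open>Scaling by \<open>\<phi> w\<close> makes \<open>\<phi> z\<close> a square,
      hence positive whatever the sign of \<open>\<phi> w\<close>.\<close>
    define z where "z = \<phi> w *\<^sub>R w"
    have z: "\<phi> z > 0"
      using w by (simp add: z_def linear_scale[OF lin] flip: power2_eq_square)
    have "continuous_on UNIV (\<lambda>t. y - t *\<^sub>R z)"
      by (intro continuous_on_diff continuous_on_const
          continuous_on_compose2[OF continuous_on_scaleR_pair, of UNIV "\<lambda>t. (t, z)", simplified]
          continuous_on_Pair continuous_on_id)
    then have "open ((\<lambda>t. y - t *\<^sub>R z) -` interior W)"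
      by (intro open_vimage open_interior)
    moreover have "0 \<in> (\<lambda>t. y - t *\<^sub>R z) -` interior W"
      using int by simp
    ultimately obtain e where e: "e > 0" "ball 0 e \<subseteq> (\<lambda>t. y - t *\<^sub>R z) -` interior W"
      by (meson open_contains_ball)
    have "e / 2 \<in> ball 0 e"
      using e by simp
    then have "y - (e / 2) *\<^sub>R z \<in> W"
      using e interior_subset by blast
    from min[OF this] show False
      using e z by (simp add: linear_diff[OF lin] linear_scale[OF lin] mult_le_0_iff)
  qed
  then show ?thesis
    using \<open>y \<in> W\<close> closure_subset by (auto simp: frontier_def)
qed

text \<open>Stated for real functions so that it serves both \<open>v\<close> and, in the reflected
  case, \<open>- v\<close>.\<close>

lemma exists_last_crossing_of_affine_family:
  fixes u v :: "'x \<Rightarrow> real"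
  assumes K: "K = {x \<in> X. u x \<le> r}"
    and comp: "compact ((\<lambda>x. (u x, v x)) ` K)"
    and p: "p \<in> K" "v p > 0"
    and nz: "\<forall>x\<in>K. v x \<noteq> 0"
  shows "\<exists>a. \<exists>x0\<in>K. v x0 > 0 \<and> u x0 + a * v x0 = r \<and>
    (\<forall>x\<in>X. \<forall>l>a. u x + l * v x > r \<longrightarrow> u x + a * v x \<ge> r)"
proof -
  \<comment> \<open>The closed condition \<open>snd q \<ge> 0\<close> preserves compactness; as
    \<open>v\<close> has no zero on \<open>K\<close>, it selects exactly the points with
    \<open>v x > 0\<close>.\<close>
  let ?S = "(\<lambda>x. (u x, v x)) ` K \<inter> {q. snd q \<ge> 0}"
  have "compact ?S"
    by (intro compact_Int_closed comp closed_Collect_le continuous_intros)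
  moreover have "?S \<noteq> {}"
    using p by force
  moreover have "continuous_on ?S (\<lambda>q. (r - fst q) / snd q)"
    using nz by (intro continuous_intros) auto
  ultimately obtain q where q: "q \<in> ?S"
    and max: "\<And>q'. q' \<in> ?S \<Longrightarrow> (r - fst q') / snd q' \<le> (r - fst q) / snd q"
    using continuous_attains_sup[of ?S "\<lambda>q. (r - fst q) / snd q"] by blast
  then obtain x0 where x0: "x0 \<in> K" "q = (u x0, v x0)" "v x0 \<ge> 0"
    by auto
  with nz have pos: "v x0 > 0"
    using less_eq_real_def by auto
  define a where "a = (r - u x0) / v x0"
  have a: "a \<ge> 0"
    using x0 pos K by (simp add: a_def)
  have "u x + a * v x \<ge> r" if x: "x \<in> X" and l: "l > a" "u x + l * v x > r" for x l
  proof (rule ccontr)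
    assume neg: "\<not> u x + a * v x \<ge> r"
    with l have "(l - a) * v x > 0"
      by (simp add: algebra_simps)
    with l have v: "v x > 0"
      by (simp add: zero_less_mult_iff)
    \<comment> \<open>Since \<open>a \<ge> 0\<close>, \<open>u x \<le> u x + a * v x < r\<close>, so
      \<open>x\<close> is in \<open>K\<close> and competes in the maximum defining
      \<open>a\<close>.\<close>
    with a have "a * v x \<ge> 0"
      by simp
    with neg x K have "x \<in> K"
      by auto
    with v have "(r - u x) / v x \<le> a"
      using max[of "(u x, v x)"] x0 by (simp add: a_def)
    with v neg show False
      by (simp add: divide_le_eq)
  qed
  moreover have "u x0 + a * v x0 = r"
    using pos by (simp add: a_def)
  ultimately show ?thesis
    using x0(1) pos by blast
qed

theorem theorem4:
  fixes X :: "'x set"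
    and f g :: "'x \<Rightarrow> 'y::{locally_convex_space, t2_space}"
    and \<phi> :: "'y \<Rightarrow> real"
    and r :: real
    and K :: "'x set"
  assumes "X \<noteq> {}"
    and "linear \<phi>" and "continuous_on UNIV \<phi>" and "\<phi> \<noteq> (\<lambda>y. 0)"
    and "K = {x \<in> X. \<phi> (f x) \<le> r}"
    and "K \<noteq> {}"
    and "compact ((\<lambda>x. (f x, g x)) ` K)"
    and "g ` K \<inter> \<phi> -` {0} = {}"
  shows "\<exists>a b :: real. \<exists>x0 \<in> K. a < b \<and>
    (\<forall>l \<in> {a<..<b}. \<phi> (f x0 + l *\<^sub>R g x0) > r) \<and>
    (let V = (\<Union>l \<in> {a<..<b}. {x \<in> X. \<phi> (f x + l *\<^sub>R g x) > r}) in
      (\<phi> (f x0 + a *\<^sub>R g x0) = r \<and>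
        (\<lambda>x. f x + a *\<^sub>R g x) ` V \<inter> \<phi> -` {..r}
          \<subseteq> frontier ((\<lambda>x. f x + a *\<^sub>R g x) ` V) \<inter> \<phi> -` {r}) \<or>
      (\<phi> (f x0 + b *\<^sub>R g x0) = r \<and>
        (\<lambda>x. f x + b *\<^sub>R g x) ` V \<inter> \<phi> -` {..r}
          \<subseteq> frontier ((\<lambda>x. f x + b *\<^sub>R g x) ` V) \<inter> \<phi> -` {r}))"
proof -
  note lin = assms(2) and cont = assms(3) and K = assms(5)
  define u v where "u x = \<phi> (f x)" and "v x = \<phi> (g x)" for x
  have \<phi>: "\<phi> (f x + l *\<^sub>R g x) = u x + l * v x" for x l
    by (simp add: u_def v_def linear_add[OF lin] linear_scale[OF lin])
  have K_uv: "K = {x \<in> X. u x \<le> r}"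
    by (simp add: K u_def)
  have nz: "\<forall>x\<in>K. v x \<noteq> 0"
    using assms(8) by (auto simp: v_def)
  have cont_fst: "continuous_on A (\<lambda>p. \<phi> (fst p))" and cont_snd: "continuous_on A (\<lambda>p. \<phi> (snd p))"
    for A :: "('y \<times> 'y) set"
    by (auto intro!: continuous_on_compose2[OF cont] continuous_intros)
  have comp: "compact ((\<lambda>x. (u x, c * v x)) ` K)" for c
    using compact_continuous_image[OF _ assms(7), of "\<lambda>p. (\<phi> (fst p), c * \<phi> (snd p))"]
    by (simp add: image_image u_def v_def continuous_on_Pair continuous_on_mult_left cont_fst cont_snd)
  \<comment> \<open>If \<open>\<phi> \<ge> r\<close> on the image, its points with
    \<open>\<phi> \<le> r\<close> minimise \<open>\<phi>\<close> there, at level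
    \<open>r\<close>.\<close>
  have image_supported: "(\<lambda>x. f x + c *\<^sub>R g x) ` V \<inter> \<phi> -` {..r}
      \<subseteq> frontier ((\<lambda>x. f x + c *\<^sub>R g x) ` V) \<inter> \<phi> -` {r}"
    if "\<And>x. x \<in> V \<Longrightarrow> u x + c * v x \<ge> r" for c V
  proof
    fix y
    assume y: "y \<in> (\<lambda>x. f x + c *\<^sub>R g x) ` V \<inter> \<phi> -` {..r}"
    then have "\<phi> y = r"
      using that \<phi> by (force intro: antisym)
    then have "y \<in> frontier ((\<lambda>x. f x + c *\<^sub>R g x) ` V)"
      using y that \<phi> by (intro supporting_hyperplane_point_in_frontier[OF lin assms(4)]) auto
    with \<open>\<phi> y = r\<close> show "y \<in> frontier ((\<lambda>x. f x + c *\<^sub>R g x) ` V) \<inter> \<phi> -` {r}"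
      by simp
  qed
  show ?thesis
  proof (cases "\<exists>p\<in>K. v p > 0")
    case True
    then obtain p where "p \<in> K" "v p > 0"
      by blast
    from exists_last_crossing_of_affine_family[OF K_uv _ this nz] comp[of 1]
    obtain a x0 where x0: "x0 \<in> K" "v x0 > 0" "u x0 + a * v x0 = r"
      and last: "\<forall>x\<in>X. \<forall>l>a. u x + l * v x > r \<longrightarrow> u x + a * v x \<ge> r"
      by auto
    \<comment> \<open>The length 1 is arbitrary: \<open>last\<close> covers every
      \<open>l > a\<close>.\<close>
    have "u x0 + l * v x0 > r" if "l \<in> {a<..<a + 1}" for l
    proof -
      have "l * v x0 > a * v x0"
        using that x0(2) by simp
      with x0(3) show ?thesis
        by linarith
    qed
    then show ?thesis
      unfolding Let_def
      by (intro exI[of _ a] exI[of _ "a + 1"] bexI[OF _ x0(1)] conjI disjI1 image_supported)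
        (auto simp: \<phi> x0(3) last)
  next
    case False
    obtain p where "p \<in> K"
      using assms(6) by blast
    with False nz have "- v p > 0"
      by (metis linorder_neqE_linordered_idom neg_0_less_iff_less)
    from exists_last_crossing_of_affine_family[OF K_uv, of "\<lambda>x. - v x", OF _ \<open>p \<in> K\<close> this] comp[of "-1"] nz
    obtain c x0 where x0: "x0 \<in> K" "- v x0 > 0" "u x0 + c * - v x0 = r"
      and last: "\<forall>x\<in>X. \<forall>l>c. u x + l * - v x > r \<longrightarrow> u x + c * - v x \<ge> r"
      by auto
    \<comment> \<open>Undoing the reflection sends \<open>l\<close> to \<open>- l\<close>, so the
      crossing \<open>c\<close> becomes the right endpoint and the interval lies to its
      left.\<close>
    define b where "b = - c"
    have "u x0 + l * v x0 > r" if "l \<in> {b - 1<..<b}" for l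
    proof -
      have "l * v x0 > b * v x0"
        using that x0(2) by simp
      with x0(3) show ?thesis
        unfolding b_def by simp
    qed
    moreover have last': "u x + b * v x \<ge> r" if "x \<in> X" "l < b" "u x + l * v x > r" for x l
      using last[rule_format, of x "- l"] that by (simp add: b_def)
    moreover have "u x0 + b * v x0 = r"
      using x0(3) by (simp add: b_def)
    ultimately show ?thesis
      unfolding Let_def
      by (intro exI[of _ "b - 1"] exI[of _ b] bexI[OF _ x0(1)] conjI disjI2 image_supported)
        (auto simp: \<phi> intro: last')
  qed
qed

end
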